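(* Let $G$ be a finite group, $p$ a prime, and $G\text{-}\mathrm{sets}$ the category of finite left $G$-sets with $G$-equivariant maps. The sipp-coverings form a basis of a Grothendieck topology on $G\text{-}\mathrm{sets}$; namely, they satisfy the following properties: (a) Every isomorphism $U\overset{\sim}{\to}X$ is a sipp-cover. (b) If $\{\alpha_i:U_i\to X\}_{i\in I}$ is a sipp-covering of $X$ and $\beta:Y\to X$ is a $G$-map, then the pull-backs define a sipp-covering $\{\mathrm{pr}_2:U_i\times_XY\to Y\}_{i\in I}$ of $Y$. (c) If $\{\alpha_i:U_i\to X\}_{i\in I}$ is a sipp-covering of $X$ and if $\{\beta_{ij}:V_{ij}\to U_i\}_{j\in J_i}$ is a sipp-covering of $U_i$ for every $i\in I$, then the composite family $\{\alpha_i\beta_{ij}:V_{ij}\to X\}_{i\in I,\,j\in J_i}$ is a sipp-covering of $X$.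
   Context: $\mathrm{St}_G(x)=\{g\in G\mid gx=x\}$. A (possibly infinite) family of $G$-maps $\{\alpha_i:U_i\to X\}_{i\in I}$ in $G\text{-}\mathrm{sets}$ is a sipp-covering if for every $x\in X$ there exist $i\in I$ and $u\in U_i$ such that $\alpha_i(u)=x$ and the index $[\mathrm{St}_G(x):\mathrm{St}_G(u)]$ is prime to $p$. A single $G$-map $U\to X$ is a sipp-cover if $\{U\to X\}$ is a sipp-covering. Pull-backs are formed on underlying sets with diagonal $G$-action. *)

theory Defs
  imports "HOL-Algebra.Group_Action" "HOL-Computational_Algebra.Primes"
begin

record ('g, 'a) gset =
  points :: "'a set"
  act :: "'g \<Rightarrow> 'a \<Rightarrow> 'a"

definition finite_gset :: "('g, 'm) monoid_scheme \<Rightarrow> ('g, 'a) gset \<Rightarrow> bool" where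
  "finite_gset G X \<longleftrightarrow> finite (points X) \<and> group_action G (points X) (act X)"

text \<open>As for \<^const>\<open>hom\<close>, only the values on the domain matter; two maps are the same
  morphism iff they agree on the points of their domain.\<close>

definition gset_hom ::
  "('g, 'm) monoid_scheme \<Rightarrow> ('g, 'a) gset \<Rightarrow> ('g, 'b) gset \<Rightarrow> ('a \<Rightarrow> 'b) set" where
  "gset_hom G X Y = {f \<in> points X \<rightarrow> points Y.
     \<forall>g\<in>carrier G. \<forall>x\<in>points X. f (act X g x) = act Y g (f x)}"

definition gset_iso ::
  "('g, 'm) monoid_scheme \<Rightarrow> ('g, 'a) gset \<Rightarrow> ('g, 'b) gset \<Rightarrow> ('a \<Rightarrow> 'b) set" where
  "gset_iso G X Y = {f \<in> gset_hom G X Y. \<exists>h\<in>gset_hom G Y X.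
     (\<forall>x\<in>points X. h (f x) = x) \<and> (\<forall>y\<in>points Y. f (h y) = y)}"

text \<open>The action is restricted to the fibre product because \<^const>\<open>BijGroup\<close> consists of
  extensional functions.\<close>

definition gset_pullback ::
  "('g, 'u) gset \<Rightarrow> ('u \<Rightarrow> 'x) \<Rightarrow> ('g, 'y) gset \<Rightarrow> ('y \<Rightarrow> 'x) \<Rightarrow> ('g, 'u \<times> 'y) gset" where
  "gset_pullback U \<alpha> Y \<beta> =
    (let P = {(u, y). u \<in> points U \<and> y \<in> points Y \<and> \<alpha> u = \<beta> y}
     in \<lparr>points = P, act = (\<lambda>g. \<lambda>(u, y)\<in>P. (act U g u, act Y g y))\<rparr>)"

text \<open>The index \<open>[H : K]\<close> of a subgroup \<open>K\<close> contained in the subgroup \<open>H\<close> of \<open>G\<close>.\<close>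

definition subgroup_index :: "('g, 'm) monoid_scheme \<Rightarrow> 'g set \<Rightarrow> 'g set \<Rightarrow> nat" where
  "subgroup_index G H K = card (rcosets\<^bsub>G\<lparr>carrier := H\<rparr>\<^esub> K)"

definition sipp_covering ::
  "('g, 'm) monoid_scheme \<Rightarrow> nat \<Rightarrow> ('g, 'x) gset \<Rightarrow> 'i set \<Rightarrow> ('i \<Rightarrow> ('g, 'u) gset)
     \<Rightarrow> ('i \<Rightarrow> 'u \<Rightarrow> 'x) \<Rightarrow> bool" where
  "sipp_covering G p X I U \<alpha> \<longleftrightarrow>
     finite_gset G X \<and>
     (\<forall>i\<in>I. finite_gset G (U i) \<and> \<alpha> i \<in> gset_hom G (U i) X) \<and>
     (\<forall>x\<in>points X. \<exists>i\<in>I. \<exists>u\<in>points (U i). \<alpha> i u = x \<and>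
        coprime (subgroup_index G (stabilizer G (act X) x) (stabilizer G (act (U i)) u)) p)"

definition sipp_cover ::
  "('g, 'm) monoid_scheme \<Rightarrow> nat \<Rightarrow> ('g, 'x) gset \<Rightarrow> ('g, 'u) gset \<Rightarrow> ('u \<Rightarrow> 'x) \<Rightarrow> bool" where
  "sipp_cover G p X U \<alpha> \<longleftrightarrow> sipp_covering G p X {()} (\<lambda>_. U) (\<lambda>_. \<alpha>)"

text \<open>\<^const>\<open>gset_pullback\<close> is the pull-back in the category of finite \<open>G\<close>-sets.\<close>

lemma finite_gset_pullback:
  assumes "group G" "finite_gset G U" "finite_gset G Y"
    and "\<alpha> \<in> gset_hom G U X" "\<beta> \<in> gset_hom G Y X"
  shows "finite_gset G (gset_pullback U \<alpha> Y \<beta>)"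
proof -
  define P where "P = {(u, y). u \<in> points U \<and> y \<in> points Y \<and> \<alpha> u = \<beta> y}"
  define \<delta> where "\<delta> = (\<lambda>g. \<lambda>(u, y)\<in>P. (act U g u, act Y g y))"
  have pb: "gset_pullback U \<alpha> Y \<beta> = \<lparr>points = P, act = \<delta>\<rparr>"
    by (simp add: gset_pullback_def P_def \<delta>_def Let_def)
  interpret group G by fact
  interpret U: group_action G "points U" "act U"
    using assms by (simp add: finite_gset_def)
  interpret Y: group_action G "points Y" "act Y"
    using assms by (simp add: finite_gset_def)
  have \<delta>: "\<delta> g (u, y) = (act U g u, act Y g y)" if "(u, y) \<in> P" for g u y
    using that by (simp add: \<delta>_def)
  have cl: "\<delta> g z \<in> P" if g: "g \<in> carrier G" and z: "z \<in> P" for g z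
  proof -
    obtain u y where uy: "z = (u, y)" "u \<in> points U" "y \<in> points Y" "\<alpha> u = \<beta> y"
      using z by (auto simp: P_def)
    have "\<alpha> (act U g u) = \<beta> (act Y g y)"
      using assms(4,5) g uy by (simp add: gset_hom_def)
    moreover have "act U g u \<in> points U" "act Y g y \<in> points Y"
      using U.element_image[OF g uy(2) refl] Y.element_image[OF g uy(3) refl] by blast+
    ultimately show ?thesis
      using z uy(1) by (simp add: \<delta>) (simp add: P_def)
  qed
  have mult: "\<delta> (g \<otimes>\<^bsub>G\<^esub> h) z = \<delta> g (\<delta> h z)"
    if g: "g \<in> carrier G" and h: "h \<in> carrier G" and z: "z \<in> P" for g h z
  proof -
    obtain u y where uy: "z = (u, y)" "u \<in> points U" "y \<in> points Y"
      using z by (auto simp: P_def)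
    have "(act U h u, act Y h y) \<in> P"
      using cl[OF h z] z uy(1) by (simp add: \<delta>)
    then show ?thesis
      using z uy(1) U.composition_rule[OF uy(2) g h] Y.composition_rule[OF uy(3) g h]
      by (simp add: \<delta>)
  qed
  have one: "\<delta> \<one>\<^bsub>G\<^esub> z = z" if z: "z \<in> P" for z
  proof -
    obtain u y where uy: "z = (u, y)" "u \<in> points U" "y \<in> points Y"
      using z by (auto simp: P_def)
    have "act U \<one>\<^bsub>G\<^esub> u = u" "act Y \<one>\<^bsub>G\<^esub> y = y"
      using fun_cong[OF U.id_eq_one, of u] fun_cong[OF Y.id_eq_one, of y] uy by simp_all
    then show ?thesis using z uy(1) by (simp add: \<delta>)
  qed
  have bij: "\<delta> g \<in> Bij P" if g: "g \<in> carrier G" for g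
  proof -
    have "bij_betw (\<delta> g) P P"
    proof (rule bij_betwI[where g = "\<delta> (inv\<^bsub>G\<^esub> g)"])
      show "\<delta> g \<in> P \<rightarrow> P" "\<delta> (inv\<^bsub>G\<^esub> g) \<in> P \<rightarrow> P"
        using cl[OF g] cl[OF inv_closed[OF g]] by blast+
      show "\<delta> (inv\<^bsub>G\<^esub> g) (\<delta> g z) = z" if "z \<in> P" for z
        using mult[OF inv_closed[OF g] g that] one[OF that] g by simp
      show "\<delta> g (\<delta> (inv\<^bsub>G\<^esub> g) z) = z" if "z \<in> P" for z
        using mult[OF g inv_closed[OF g] that] one[OF that] g by simp
    qed
    moreover have "\<delta> g \<in> extensional P" by (simp add: \<delta>_def)
    ultimately show ?thesis by (simp add: Bij_def)
  qed
  have "\<delta> \<in> hom G (BijGroup P)"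
  proof (rule homI)
    show "\<delta> g \<in> carrier (BijGroup P)" if "g \<in> carrier G" for g
      using bij[OF that] by (simp add: BijGroup_def)
    show "\<delta> (g \<otimes>\<^bsub>G\<^esub> h) = \<delta> g \<otimes>\<^bsub>BijGroup P\<^esub> \<delta> h"
      if "g \<in> carrier G" "h \<in> carrier G" for g h
    proof
      fix z
      show "\<delta> (g \<otimes>\<^bsub>G\<^esub> h) z = (\<delta> g \<otimes>\<^bsub>BijGroup P\<^esub> \<delta> h) z"
        using bij[OF that(1)] bij[OF that(2)] mult[OF that, of z]
        by (cases "z \<in> P") (simp_all add: BijGroup_def compose_def \<delta>_def)
    qed
  qed
  then have "group_action G P \<delta>"
    by (simp add: group_action_def group_hom_def group_hom_axioms_def group_BijGroup is_group)
  moreover have "finite P"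
    by (rule finite_subset[of _ "points U \<times> points Y"])
      (use assms in \<open>auto simp: P_def finite_gset_def\<close>)
  ultimately show ?thesis by (simp add: pb finite_gset_def)
qed

lemma gset_pullback_projections:
  "fst \<in> gset_hom G (gset_pullback U \<alpha> Y \<beta>) U"
  "snd \<in> gset_hom G (gset_pullback U \<alpha> Y \<beta>) Y"
  "z \<in> points (gset_pullback U \<alpha> Y \<beta>) \<Longrightarrow> \<alpha> (fst z) = \<beta> (snd z)"
  by (auto simp: gset_hom_def gset_pullback_def Let_def)

lemma gset_pullback_universal:
  assumes "finite_gset G T"
    and "a \<in> gset_hom G T U" "b \<in> gset_hom G T Y"
    and "\<And>t. t \<in> points T \<Longrightarrow> \<alpha> (a t) = \<beta> (b t)"
  shows "\<exists>h\<in>gset_hom G T (gset_pullback U \<alpha> Y \<beta>).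
           (\<forall>t\<in>points T. fst (h t) = a t \<and> snd (h t) = b t) \<and>
           (\<forall>h'\<in>gset_hom G T (gset_pullback U \<alpha> Y \<beta>).
              (\<forall>t\<in>points T. fst (h' t) = a t \<and> snd (h' t) = b t) \<longrightarrow>
              (\<forall>t\<in>points T. h' t = h t))"
proof (rule bexI[of _ "\<lambda>t. (a t, b t)"])
  show "(\<lambda>t. (a t, b t)) \<in> gset_hom G T (gset_pullback U \<alpha> Y \<beta>)"
    using assms by (auto simp: gset_hom_def gset_pullback_def Let_def Pi_iff)
qed (auto simp: prod_eq_iff)

end

theory Submission
  imports Defs
begin

text \<open>
  Parts (a) and (c) are formal. An isomorphism preserves stabilizers, so the index in question
  is 1; and for a composite \<open>v \<mapsto> u \<mapsto> x\<close> the stabilizers form a tower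
  \<open>St v \<le> St u \<le> St x\<close>, along which indices multiply and coprimality to \<open>p\<close> is preserved.

  Part (b) has content, because a point \<open>u\<close> over \<open>x = \<beta> y\<close> with \<open>[St x : St u]\<close> prime to \<open>p\<close>
  need not give a suitable point \<open>(u, y)\<close> of the pull-back: the index
  \<open>[St y : St u \<inter> St y]\<close> may be divisible by \<open>p\<close>. One may however move \<open>u\<close> within the fibre by
  an element of \<open>St x\<close>. The orbit of \<open>u\<close> under \<open>St x\<close> has \<open>[St x : St u]\<close> elements, a number not
  divisible by \<open>p\<close>, and the subgroup \<open>St y\<close> of \<open>St x\<close> acts on it. The orbits of \<open>St y\<close> partition
  it, so one of them, say that of \<open>u'\<close>, has size not divisible by \<open>p\<close>. This size is
  \<open>[St y : St u' \<inter> St y]\<close>, and \<open>St u' \<inter> St y\<close> is the stabilizer of \<open>(u', y)\<close>. The argument is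
  \<open>exists_translate_coprime_index\<close>; it rests on \<open>exists_orbit_not_dvd\<close> and on reading indices as
  orbit sizes, \<open>subgroup_index_eq_card_orbit\<close>.
\<close>

section \<open>Indices of subgroups\<close>

lemma (in group) subgroup_index_times_card:
  assumes "subgroup H G" "subgroup K G" "K \<subseteq> H"
  shows "subgroup_index G H K * card K = card H"
  using group.lagrange[OF subgroup_imp_group[OF assms(1)] subgroup_incl[OF assms(2,1,3)]]
  by (simp add: subgroup_index_def order_def)

lemma (in group) card_subgroup_pos:
  assumes "finite (carrier G)" "subgroup H G"
  shows "card H > 0"
  using finite_subset[OF subgroup.subset[OF assms(2)] assms(1)] subgroup.one_closed[OF assms(2)]
  by (auto simp: card_gt_0_iff)

lemma (in group) subgroup_index_self:
  assumes "finite (carrier G)" "subgroup H G"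
  shows "subgroup_index G H H = 1"
  using subgroup_index_times_card[OF assms(2,2) subset_refl] card_subgroup_pos[OF assms] by simp

lemma (in group) subgroup_index_tower:
  assumes fin: "finite (carrier G)"
    and H: "subgroup H G" and K: "subgroup K G" and L: "subgroup L G"
    and sub: "K \<subseteq> H" "L \<subseteq> K"
  shows "subgroup_index G H L = subgroup_index G H K * subgroup_index G K L"
proof -
  have "L \<subseteq> H" using sub by blast
  then have "subgroup_index G H L * card L = subgroup_index G H K * subgroup_index G K L * card L"
    using subgroup_index_times_card[OF H L] subgroup_index_times_card[OF H K sub(1)]
      subgroup_index_times_card[OF K L sub(2)] by (simp add: mult.assoc)
  then show ?thesis using card_subgroup_pos[OF fin L] by simp
qed

section \<open>Orbits whose size is prime to p\<close>

text \<open>The orbit-stabilizer bijection for the action restricted to \<open>H\<close>, in which the stabilizer of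
  \<open>x\<close> is \<open>H \<inter> St x\<close>. It turns questions about indices into counting questions about orbits.\<close>

lemma (in group_action) subgroup_index_eq_card_orbit:
  assumes "subgroup H G" "x \<in> E"
  shows "subgroup_index G H (H \<inter> stabilizer G \<phi> x) = card (orbit (G\<lparr>carrier := H\<rparr>) \<phi> x)"
proof -
  interpret H: group_action "G\<lparr>carrier := H\<rparr>" E \<phi>
    by (rule induced_action[OF assms(1)])
  have "stabilizer (G\<lparr>carrier := H\<rparr>) \<phi> x = H \<inter> stabilizer G \<phi> x"
    using subgroup.subset[OF assms(1)] by (auto simp: stabilizer_def)
  then show ?thesis
    using bij_betw_same_card[OF H.orbit_stab_fun_is_bij[OF assms(2)]]
    by (simp add: subgroup_index_def)
qed

text \<open>An invariant set is a disjoint union of orbits, so a number dividing the size of each of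
  them divides the size of the set.\<close>

lemma (in group_action) exists_orbit_not_dvd:
  assumes "finite S" "S \<subseteq> E" and inv: "\<And>g s. g \<in> carrier G \<Longrightarrow> s \<in> S \<Longrightarrow> \<phi> g s \<in> S"
    and ndvd: "\<not> n dvd card S"
  shows "\<exists>s\<in>S. \<not> n dvd card (orbit G \<phi> s)"
proof (rule ccontr)
  assume "\<not> ?thesis"
  then have dvd: "n dvd card c" if "c \<in> orbit G \<phi> ` S" for c using that by blast
  have "orbit G \<phi> s \<subseteq> S" if "s \<in> S" for s
    using inv that by (auto simp: orbit_def)
  moreover have "s \<in> orbit G \<phi> s" if "s \<in> S" for s
    using orbit_refl that assms(2) by blast
  ultimately have union: "\<Union> (orbit G \<phi> ` S) = S" by blast
  have disj: "c \<inter> d = {}" if "c \<in> orbit G \<phi> ` S" "d \<in> orbit G \<phi> ` S" "c \<noteq> d" for c d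
    using disjoint_union[of c d] that assms(2) by (auto simp: orbits_def)
  have "n dvd card (\<Union> (orbit G \<phi> ` S))"
    using assms(1) union dvd disj by (intro dvd_partition) auto
  then show False using ndvd union by simp
qed

text \<open>This is what makes pull-backs work: coprimality of an index passes to a smaller subgroup
  \<open>L\<close> once the point is moved to a suitable place in its \<open>H\<close>-orbit.\<close>

lemma (in group_action) exists_translate_coprime_index:
  assumes "finite E" and H: "subgroup H G" and L: "subgroup L G" "L \<subseteq> H"
    and u: "u \<in> E" "stabilizer G \<phi> u \<subseteq> H"
    and p: "prime p" "coprime (subgroup_index G H (stabilizer G \<phi> u)) p"
  shows "\<exists>h\<in>H. coprime (subgroup_index G L (L \<inter> stabilizer G \<phi> (\<phi> h u))) p"
proof -
  interpret L: group_action "G\<lparr>carrier := L\<rparr>" E \<phi>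
    by (rule induced_action[OF L(1)])
  define S where "S = orbit (G\<lparr>carrier := H\<rparr>) \<phi> u"
  have S_eq: "S = (\<lambda>h. \<phi> h u) ` H" by (auto simp: S_def orbit_def)
  have SE: "S \<subseteq> E"
    using element_image u(1) subgroup.mem_carrier[OF H] by (auto simp: S_eq)
  have "H \<inter> stabilizer G \<phi> u = stabilizer G \<phi> u" using u(2) by blast
  then have "subgroup_index G H (stabilizer G \<phi> u) = card S"
    using subgroup_index_eq_card_orbit[OF H u(1)] by (simp add: S_def)
  then have "\<not> p dvd card S"
    using p by (metis coprime_commute coprime_absorb_left not_prime_unit)
  moreover have "\<phi> g s \<in> S" if gL: "g \<in> L" and sS: "s \<in> S" for g s
  proof -
    obtain h where h: "h \<in> H" "s = \<phi> h u" using sS by (auto simp: S_eq)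
    have g: "g \<in> H" using gL L(2) by blast
    have "\<phi> g s = \<phi> (g \<otimes> h) u"
      using composition_rule[OF u(1)] subgroup.mem_carrier[OF H] g h by simp
    then show ?thesis using subgroup.m_closed[OF H g h(1)] by (auto simp: S_eq)
  qed
  ultimately obtain s where s: "s \<in> S" "\<not> p dvd card (orbit (G\<lparr>carrier := L\<rparr>) \<phi> s)"
    using L.exists_orbit_not_dvd[of S p] SE finite_subset[OF SE \<open>finite E\<close>] by auto
  then obtain h where h: "h \<in> H" "s = \<phi> h u" by (auto simp: S_eq)
  have "s \<in> E" using s(1) SE by blast
  then have "\<not> p dvd subgroup_index G L (L \<inter> stabilizer G \<phi> (\<phi> h u))"
    using s(2) h(2) subgroup_index_eq_card_orbit[OF L(1)] by simp
  then show ?thesis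
    using h(1) prime_imp_coprime[OF p(1)] coprime_commute by blast
qed

section \<open>Stabilizers under equivariant maps\<close>

lemma stabilizer_subset_image:
  assumes "f \<in> gset_hom G X Y" "x \<in> points X"
  shows "stabilizer G (act X) x \<subseteq> stabilizer G (act Y) (f x)"
  using assms by (auto simp: gset_hom_def stabilizer_def) metis

lemma stabilizer_iso:
  assumes "f \<in> gset_iso G X Y" "x \<in> points X"
  shows "stabilizer G (act Y) (f x) = stabilizer G (act X) x"
proof
  obtain h where f: "f \<in> gset_hom G X Y" and h: "h \<in> gset_hom G Y X" "h (f x) = x"
    using assms by (auto simp: gset_iso_def)
  show "stabilizer G (act X) x \<subseteq> stabilizer G (act Y) (f x)"
    by (rule stabilizer_subset_image[OF f assms(2)])
  have "f x \<in> points Y" using f assms(2) by (auto simp: gset_hom_def)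
  from stabilizer_subset_image[OF h(1) this]
  show "stabilizer G (act Y) (f x) \<subseteq> stabilizer G (act X) x" by (simp add: h(2))
qed

lemma stabilizer_gset_pullback:
  assumes "(u, y) \<in> points (gset_pullback U \<alpha> Y \<beta>)"
  shows "stabilizer G (act (gset_pullback U \<alpha> Y \<beta>)) (u, y)
    = stabilizer G (act Y) y \<inter> stabilizer G (act U) u"
  using assms by (auto simp: stabilizer_def gset_pullback_def Let_def)

lemma subgroup_stabilizer:
  assumes "finite_gset G X" "x \<in> points X"
  shows "subgroup (stabilizer G (act X) x) G"
  using assms group_action.stabilizer_subgroup by (auto simp: finite_gset_def)

section \<open>The covering axioms\<close>

lemma gset_hom_comp:
  assumes "f \<in> gset_hom G X Y" "h \<in> gset_hom G Y Z"
  shows "h \<circ> f \<in> gset_hom G X Z"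
  using assms by (auto simp: gset_hom_def Pi_iff)

lemma sipp_cover_iso:
  assumes "group G" "finite (carrier G)" and fin: "finite_gset G X" "finite_gset G U"
    and \<alpha>: "\<alpha> \<in> gset_iso G U X"
  shows "sipp_cover G p X U \<alpha>"
proof -
  have "\<exists>u\<in>points U. \<alpha> u = x \<and>
      coprime (subgroup_index G (stabilizer G (act X) x) (stabilizer G (act U) u)) p"
    if x: "x \<in> points X" for x
  proof -
    obtain u where u: "u \<in> points U" "\<alpha> u = x"
      using \<alpha> x by (auto simp: gset_iso_def gset_hom_def Pi_iff)
    then show ?thesis
      using stabilizer_iso[OF \<alpha> u(1)] subgroup_stabilizer[OF fin(2) u(1)]
        group.subgroup_index_self[OF assms(1,2)] by (intro bexI[of _ u]) simp_all
  qed
  then show ?thesis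
    using fin \<alpha> by (simp add: sipp_cover_def sipp_covering_def gset_iso_def)
qed

lemma sipp_covering_pullback:
  assumes "group G" "prime p" and cov: "sipp_covering G p X I U \<alpha>"
    and Y: "finite_gset G Y" and \<beta>: "\<beta> \<in> gset_hom G Y X"
  shows "sipp_covering G p Y I (\<lambda>i. gset_pullback (U i) (\<alpha> i) Y \<beta>) (\<lambda>i. snd)"
proof -
  have X: "finite_gset G X" and U: "\<And>i. i \<in> I \<Longrightarrow> finite_gset G (U i)"
    and \<alpha>: "\<And>i. i \<in> I \<Longrightarrow> \<alpha> i \<in> gset_hom G (U i) X"
    using cov by (simp_all add: sipp_covering_def)
  have "\<exists>i\<in>I. \<exists>z\<in>points (gset_pullback (U i) (\<alpha> i) Y \<beta>). snd z = y \<and>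
      coprime (subgroup_index G (stabilizer G (act Y) y)
        (stabilizer G (act (gset_pullback (U i) (\<alpha> i) Y \<beta>)) z)) p"
    if y: "y \<in> points Y" for y
  proof -
    have x: "\<beta> y \<in> points X" using \<beta> y by (auto simp: gset_hom_def)
    then obtain i u where i: "i \<in> I" and u: "u \<in> points (U i)" "\<alpha> i u = \<beta> y"
      and cop: "coprime (subgroup_index G (stabilizer G (act X) (\<beta> y)) (stabilizer G (act (U i)) u)) p"
      using cov unfolding sipp_covering_def by metis
    interpret group_action G "points (U i)" "act (U i)"
      using U[OF i] by (simp add: finite_gset_def)
    have "finite (points (U i))" using U[OF i] by (simp add: finite_gset_def)
    from exists_translate_coprime_index[OF this subgroup_stabilizer[OF X x]
        subgroup_stabilizer[OF Y y] stabilizer_subset_image[OF \<beta> y] u(1) _ \<open>prime p\<close> cop]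
    obtain h where h: "h \<in> stabilizer G (act X) (\<beta> y)"
      and h_cop: "coprime (subgroup_index G (stabilizer G (act Y) y)
        (stabilizer G (act Y) y \<inter> stabilizer G (act (U i)) (act (U i) h u))) p"
      using stabilizer_subset_image[OF \<alpha>[OF i] u(1)] u(2) by auto
    define u' where "u' = act (U i) h u"
    have hG: "h \<in> carrier G" and hx: "act X h (\<beta> y) = \<beta> y"
      using h by (simp_all add: stabilizer_def)
    have "u' \<in> points (U i)" using element_image[OF hG u(1)] by (simp add: u'_def)
    (* h fixes \<beta> y, so moving u by h does not leave the fibre over \<beta> y *)
    moreover have "\<alpha> i u' = \<beta> y"
      using \<alpha>[OF i] hG u hx by (simp add: u'_def gset_hom_def)
    ultimately have z: "(u', y) \<in> points (gset_pullback (U i) (\<alpha> i) Y \<beta>)"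
      using y by (simp add: gset_pullback_def Let_def)
    then show ?thesis
      using i h_cop stabilizer_gset_pullback[OF z, of G]
      by (intro bexI[of _ i] bexI[of _ "(u', y)"]) (simp_all add: u'_def)
  qed
  then show ?thesis
    using Y finite_gset_pullback[OF assms(1) U Y \<alpha> \<beta>] gset_pullback_projections(2)
    unfolding sipp_covering_def by blast
qed

lemma sipp_covering_comp:
  assumes "group G" "finite (carrier G)" and cov: "sipp_covering G p X I U \<alpha>"
    and cov': "\<And>i. i \<in> I \<Longrightarrow> sipp_covering G p (U i) (J i) (V i) (\<beta> i)"
  shows "sipp_covering G p X (SIGMA i:I. J i) (\<lambda>(i, j). V i j) (\<lambda>(i, j). \<alpha> i \<circ> \<beta> i j)"
proof -
  interpret group G by fact
  have X: "finite_gset G X" and U: "\<And>i. i \<in> I \<Longrightarrow> finite_gset G (U i)"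
    and \<alpha>: "\<And>i. i \<in> I \<Longrightarrow> \<alpha> i \<in> gset_hom G (U i) X"
    using cov by (simp_all add: sipp_covering_def)
  have V: "finite_gset G (V i j)" and \<beta>: "\<beta> i j \<in> gset_hom G (V i j) (U i)"
    if "i \<in> I" "j \<in> J i" for i j
    using cov'[OF that(1)] that(2) by (simp_all add: sipp_covering_def)
  have "\<exists>i\<in>I. \<exists>j\<in>J i. \<exists>v\<in>points (V i j). \<alpha> i (\<beta> i j v) = x \<and>
      coprime (subgroup_index G (stabilizer G (act X) x) (stabilizer G (act (V i j)) v)) p"
    if x: "x \<in> points X" for x
  proof -
    obtain i u where i: "i \<in> I" and u: "u \<in> points (U i)" "\<alpha> i u = x"
      and cop_u: "coprime (subgroup_index G (stabilizer G (act X) x) (stabilizer G (act (U i)) u)) p"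
      using cov x unfolding sipp_covering_def by metis
    obtain j v where j: "j \<in> J i" and v: "v \<in> points (V i j)" "\<beta> i j v = u"
      and cop_v: "coprime (subgroup_index G (stabilizer G (act (U i)) u) (stabilizer G (act (V i j)) v)) p"
      using cov'[OF i] u(1) unfolding sipp_covering_def by metis
    have "stabilizer G (act (U i)) u \<subseteq> stabilizer G (act X) x"
      using stabilizer_subset_image[OF \<alpha>[OF i] u(1)] u(2) by simp
    moreover have "stabilizer G (act (V i j)) v \<subseteq> stabilizer G (act (U i)) u"
      using stabilizer_subset_image[OF \<beta>[OF i j] v(1)] v(2) by simp
    ultimately have "subgroup_index G (stabilizer G (act X) x) (stabilizer G (act (V i j)) v)
      = subgroup_index G (stabilizer G (act X) x) (stabilizer G (act (U i)) u)
        * subgroup_index G (stabilizer G (act (U i)) u) (stabilizer G (act (V i j)) v)"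
      using assms(2) subgroup_stabilizer[OF X x] subgroup_stabilizer[OF U[OF i] u(1)]
        subgroup_stabilizer[OF V[OF i j] v(1)] by (intro subgroup_index_tower)
    then have "coprime (subgroup_index G (stabilizer G (act X) x) (stabilizer G (act (V i j)) v)) p"
      using cop_u cop_v by simp
    then show ?thesis using i j u v by blast
  qed
  moreover have "\<alpha> i \<circ> \<beta> i j \<in> gset_hom G (V i j) X" if "i \<in> I" "j \<in> J i" for i j
    using gset_hom_comp[OF \<beta>[OF that] \<alpha>[OF that(1)]] .
  ultimately show ?thesis
    using X V by (fastforce simp: sipp_covering_def)
qed

theorem theorem5p11:
  fixes G :: "('g, 'm) monoid_scheme" and p :: nat
  assumes "group G" and "finite (carrier G)" and "prime p"
  shows "(\<forall>(X :: ('g, 'x) gset) (U :: ('g, 'u) gset) \<alpha>.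
            finite_gset G X \<longrightarrow> finite_gset G U \<longrightarrow> \<alpha> \<in> gset_iso G U X \<longrightarrow>
            sipp_cover G p X U \<alpha>)
       \<and> (\<forall>(X :: ('g, 'x) gset) (I :: 'i set) (U :: 'i \<Rightarrow> ('g, 'u) gset) \<alpha>
            (Y :: ('g, 'y) gset) \<beta>.
            sipp_covering G p X I U \<alpha> \<longrightarrow> finite_gset G Y \<longrightarrow> \<beta> \<in> gset_hom G Y X \<longrightarrow>
            sipp_covering G p Y I (\<lambda>i. gset_pullback (U i) (\<alpha> i) Y \<beta>) (\<lambda>i. snd))
       \<and> (\<forall>(X :: ('g, 'x) gset) (I :: 'i set) (U :: 'i \<Rightarrow> ('g, 'u) gset) \<alpha>
            (J :: 'i \<Rightarrow> 'j set) (V :: 'i \<Rightarrow> 'j \<Rightarrow> ('g, 'v) gset) \<beta>.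
            sipp_covering G p X I U \<alpha> \<longrightarrow>
            (\<forall>i\<in>I. sipp_covering G p (U i) (J i) (V i) (\<beta> i)) \<longrightarrow>
            sipp_covering G p X (SIGMA i:I. J i) (\<lambda>(i, j). V i j)
              (\<lambda>(i, j). \<alpha> i \<circ> \<beta> i j))"
proof (intro conjI allI impI, goal_cases)
  case 1
  then show ?case by (rule sipp_cover_iso[OF assms(1,2)])
next
  case 2
  then show ?case by (rule sipp_covering_pullback[OF assms(1,3)])
next
  case 3
  then show ?case by (intro sipp_covering_comp[OF assms(1,2) 3(1)] bspec[OF 3(2)])
qed

end
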